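(* Let $A$ be a complex $n\times n$ matrix. Condition C1 holds for $A$ in each of the following cases: 1) $n=2$ or $n=3$; 2) $A$ has rank $1$; 3) $A$ is upper triangular or lower triangular; 4) all the principal minors of $A$ are non-zero. In particular (from case 4), the set of matrices $A\in\mathcal{M}_n$ for which Condition C1 holds is dense in $\mathcal{M}_n$.
   Context: For $u,v\in\mathbb{C}^n$, $u*v=(u_1v_1,\ldots,u_nv_n)$ is the coordinatewise product, $u^k$ is the coordinatewise $k$-th power, and $\Delta[u]$ is the diagonal $n\times n$ matrix with $(i,i)$ entry $u_i$. $\mathcal{M}_n$ is the set of complex $n\times n$ matrices. Define $$V_n=\{(y,z,A)\in\mathbb{C}^n\times\mathbb{C}^n\times\mathcal{M}_n:\ \det(Id+\Delta[(sz+ty)^2].A)=1\ \forall s,t\in\mathbb{C},\ z+A.(z^3+z*y^2)=0\}.$$ An $n\times n$ matrix $A$ satisfies Condition C1 if whenever $(y,z,A)\in V_n$ then $z=0$. A principal minor of $A$ is the determinant of a matrix obtained from $A$ by deleting $k$ rows $i_1,\ldots,i_k$ and the $k$ columns with the same indices $i_1,\ldots,i_k$. *)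

theory Defs
  imports
    "HOL-Analysis.Abstract_Metric_Spaces"
    "Jordan_Normal_Form.Determinant"
    "Jordan_Normal_Form.DL_Rank"
    "Jordan_Normal_Form.DL_Submatrix"
begin

unbundle no vec_syntax

text \<open>Points of $\mathbb{C}^n$ are the elements of \<^term>\<open>carrier_vec n :: complex vec set\<close> and
  $\mathcal{M}_n$ is \<^term>\<open>carrier_mat n n :: complex mat set\<close>; indices run from \<open>0\<close> to \<open>n - 1\<close>.\<close>

definition vec_prod :: "complex vec \<Rightarrow> complex vec \<Rightarrow> complex vec" (infixl \<open>\<star>\<^sub>v\<close> 70)
  where "u \<star>\<^sub>v v = vec (dim_vec u) (\<lambda>i. u $ i * v $ i)"

definition vec_pow :: "complex vec \<Rightarrow> nat \<Rightarrow> complex vec" (infixr \<open>^\<^sub>v\<close> 80)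
  where "u ^\<^sub>v k = vec (dim_vec u) (\<lambda>i. (u $ i) ^ k)"

definition vec_diag :: "complex vec \<Rightarrow> complex mat"
  where "vec_diag u = mat_diag (dim_vec u) (\<lambda>i. u $ i)"

definition V :: "nat \<Rightarrow> (complex vec \<times> complex vec \<times> complex mat) set"
  where "V n = {(y, z, A). y \<in> carrier_vec n \<and> z \<in> carrier_vec n \<and> A \<in> carrier_mat n n \<and>
    (\<forall>s t. det (1\<^sub>m n + vec_diag ((s \<cdot>\<^sub>v z + t \<cdot>\<^sub>v y) ^\<^sub>v 2) * A) = 1) \<and>
    z + A *\<^sub>v (z ^\<^sub>v 3 + z \<star>\<^sub>v y ^\<^sub>v 2) = 0\<^sub>v n}"

definition condition_C1 :: "nat \<Rightarrow> complex mat \<Rightarrow> bool"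
  where "condition_C1 n A \<longleftrightarrow> (\<forall>y z. (y, z, A) \<in> V n \<longrightarrow> z = 0\<^sub>v n)"

text \<open>\<open>K\<close> is the set of indices of the deleted rows and columns; \<^const>\<open>submatrix\<close> takes the sets
  of indices that are kept. The choice \<open>K = {}\<close> gives \<^term>\<open>det A\<close> itself.\<close>

definition principal_minors :: "nat \<Rightarrow> complex mat \<Rightarrow> complex set"
  where "principal_minors n A =
    {det (submatrix A ({..<n} - K) ({..<n} - K)) | K. K \<subset> {..<n}}"

text \<open>The type of matrices carries no topology, so $\mathcal{M}_n$ is given the usual topology of a
  finite-dimensional normed space, here through the entrywise $\ell^1$ norm.\<close>

definition mat_dist :: "nat \<Rightarrow> complex mat \<Rightarrow> complex mat \<Rightarrow> real"
  where "mat_dist n A B = (\<Sum>i<n. \<Sum>j<n. cmod (A $$ (i, j) - B $$ (i, j)))"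

lemma Metric_space_mat: "Metric_space (carrier_mat n n) (mat_dist n)"
proof
  show "0 \<le> mat_dist n A B" for A B
    by (simp add: mat_dist_def sum_nonneg)
  show "mat_dist n A B = mat_dist n B A" for A B
    by (simp add: mat_dist_def norm_minus_commute)
  show "(mat_dist n A B = 0) = (A = B)"
    if A: "A \<in> carrier_mat n n" and B: "B \<in> carrier_mat n n" for A B
  proof
    assume "mat_dist n A B = 0"
    then have "\<forall>i\<in>{..<n}. (\<Sum>j<n. cmod (A $$ (i, j) - B $$ (i, j))) = 0"
      unfolding mat_dist_def by (subst (asm) sum_nonneg_eq_0_iff) (simp_all add: sum_nonneg)
    then have "\<forall>i\<in>{..<n}. \<forall>j\<in>{..<n}. cmod (A $$ (i, j) - B $$ (i, j)) = 0"
      by (subst (asm) sum_nonneg_eq_0_iff) simp_all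
    then show "A = B"
      using A B by (intro eq_matI) simp_all
  next
    assume "A = B"
    then show "mat_dist n A B = 0"
      by (simp add: mat_dist_def)
  qed
  show "mat_dist n A C \<le> mat_dist n A B + mat_dist n B C" for A B C
  proof -
    have "cmod (A $$ (i, j) - C $$ (i, j))
        \<le> cmod (A $$ (i, j) - B $$ (i, j)) + cmod (B $$ (i, j) - C $$ (i, j))" for i j
      using norm_triangle_ineq[of "A $$ (i, j) - B $$ (i, j)" "B $$ (i, j) - C $$ (i, j)"] by simp
    then show ?thesis
      unfolding mat_dist_def sum.distrib[symmetric] by (intro sum_mono)
  qed
qed

definition mat_topology :: "nat \<Rightarrow> complex mat topology"
  where "mat_topology n = Metric_space.mtopology (carrier_mat n n) (mat_dist n)"

lemma topspace_mat_topology: "topspace (mat_topology n) = carrier_mat n n"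
  by (simp add: mat_topology_def Metric_space.topspace_mtopology[OF Metric_space_mat])

end

(* With D the diagonal matrix of z^2 + y^2, the equation z = - A (z^3 + z y^2) reads z = - A D z, so
   D z is a kernel vector of 1 + D A, and z = 0 as soon as det (1 + D A) is nonzero.  The determinant
   hypothesis concerns the squares of the linear forms s z_i + t y_i instead.  The two are related in
   two ways: if at most two directions (z_i, y_i) occur, then some s, t satisfy
   (s z_i + t y_i)^2 = z_i^2 + y_i^2 for all i; and whenever det (1 + D A) depends on D only through
   quantities additive in D (rank 1, triangular, three independent forms), adding the hypotheses at
   (s, t) = (1, 0) and (0, 1) suffices.  If no principal minor vanishes, the block of A on the common
   support of z and y shows that this support is empty.  The matrices A + x have nonzero principal
   minors for all but finitely many x, whence density. *)

theory Submission
  imports Defs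
    "Jordan_Normal_Form.DL_Rank_Submatrix"
    "Jordan_Normal_Form.Spectral_Radius"
begin

section \<open>Singularity of \<open>1 + D A\<close> for diagonal \<open>D\<close>\<close>

text \<open>\<open>D\<close> is a function on indices and the product is written entrywise, so
  rewriting or scaling \<open>D\<close> raises no dimension conditions.\<close>

definition id_plus_diag :: "nat \<Rightarrow> (nat \<Rightarrow> complex) \<Rightarrow> complex mat \<Rightarrow> complex mat"
  where "id_plus_diag n d A = mat n n (\<lambda>(i, j). of_bool (i = j) + d i * A $$ (i, j))"

lemma id_plus_diag_carrier [simp]: "id_plus_diag n d A \<in> carrier_mat n n"
  by (simp add: id_plus_diag_def)

lemma id_plus_diag_index [simp]:
  "i < n \<Longrightarrow> j < n \<Longrightarrow> id_plus_diag n d A $$ (i, j) = of_bool (i = j) + d i * A $$ (i, j)"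
  by (simp add: id_plus_diag_def)

lemma id_plus_diag_cong:
  "(\<And>i. i < n \<Longrightarrow> d i = d' i) \<Longrightarrow> id_plus_diag n d A = id_plus_diag n d' A"
  by (auto simp: id_plus_diag_def intro!: cong_mat)

text \<open>Over a field, singularity means a nonzero kernel vector. Vectors become functions here,
  so that candidates can be given by formulas in the index.\<close>

lemma det_id_plus_diag_eq_0_iff:
  "det (id_plus_diag n d A) = 0 \<longleftrightarrow>
    (\<exists>x. (\<exists>i<n. x i \<noteq> 0) \<and> (\<forall>i<n. x i + d i * (\<Sum>j<n. A $$ (i, j) * x j) = 0))"
proof -
  have mult: "(id_plus_diag n d A *\<^sub>v v) $ i = v $ i + d i * (\<Sum>j<n. A $$ (i, j) * v $ j)"
    if "v \<in> carrier_vec n" "i < n" for v i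
  proof -
    have "(id_plus_diag n d A *\<^sub>v v) $ i
        = (\<Sum>j<n. (of_bool (i = j) + d i * A $$ (i, j)) * v $ j)"
      using that by (auto simp: id_plus_diag_def scalar_prod_def lessThan_atLeast0 intro!: sum.cong)
    also have "\<dots> = (\<Sum>j<n. (if i = j then v $ j else 0) + d i * (A $$ (i, j) * v $ j))"
      by (intro sum.cong) (auto simp: algebra_simps)
    finally show ?thesis
      using that by (simp add: sum.distrib sum_distrib_left)
  qed
  show ?thesis
    unfolding det_0_iff_vec_prod_zero_field[OF id_plus_diag_carrier]
  proof
    assume "\<exists>v. v \<in> carrier_vec n \<and> v \<noteq> 0\<^sub>v n \<and> id_plus_diag n d A *\<^sub>v v = 0\<^sub>v n"
    then obtain v where v: "v \<in> carrier_vec n" "v \<noteq> 0\<^sub>v n" "id_plus_diag n d A *\<^sub>v v = 0\<^sub>v n"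
      by blast
    have "\<exists>i<n. v $ i \<noteq> 0"
      using v(1,2) by (metis carrier_vecD eq_vecI index_zero_vec)
    moreover have "\<forall>i<n. v $ i + d i * (\<Sum>j<n. A $$ (i, j) * v $ j) = 0"
      using mult[OF v(1)] v(3) by (metis index_zero_vec(1))
    ultimately show "\<exists>x. (\<exists>i<n. x i \<noteq> 0) \<and> (\<forall>i<n. x i + d i * (\<Sum>j<n. A $$ (i, j) * x j) = 0)"
      by (intro exI[of _ "\<lambda>i. v $ i"]) blast
  next
    assume "\<exists>x. (\<exists>i<n. x i \<noteq> 0) \<and> (\<forall>i<n. x i + d i * (\<Sum>j<n. A $$ (i, j) * x j) = 0)"
    then obtain x where x: "\<exists>i<n. x i \<noteq> 0" "\<forall>i<n. x i + d i * (\<Sum>j<n. A $$ (i, j) * x j) = 0"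
      by blast
    have "vec n x \<noteq> 0\<^sub>v n"
      using x(1) by (metis index_vec index_zero_vec(1))
    moreover have "id_plus_diag n d A *\<^sub>v vec n x = 0\<^sub>v n"
    proof (rule eq_vecI)
      fix i assume "i < dim_vec (0\<^sub>v n :: complex vec)"
      then have i: "i < n" by simp
      have "(id_plus_diag n d A *\<^sub>v vec n x) $ i = x i + d i * (\<Sum>j<n. A $$ (i, j) * x j)"
        using mult[OF vec_carrier i, of x] i by simp
      then show "(id_plus_diag n d A *\<^sub>v vec n x) $ i = 0\<^sub>v n $ i"
        using x(2) i by simp
    qed (simp add: id_plus_diag_def)
    ultimately show "\<exists>v. v \<in> carrier_vec n \<and> v \<noteq> 0\<^sub>v n \<and> id_plus_diag n d A *\<^sub>v v = 0\<^sub>v n"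
      by (metis vec_carrier)
  qed
qed

text \<open>Factoring \<open>z^3 + z y^2\<close> as \<open>(z^2 + y^2) z\<close> brings the vector
  equation into the form \<open>z + A D z = 0\<close>.\<close>

lemma mem_V_D:
  assumes "(y, z, A) \<in> V n"
  shows "det (id_plus_diag n (\<lambda>i. (s * z $ i + t * y $ i)\<^sup>2) A) = 1"
    and "i < n \<Longrightarrow> z $ i + (\<Sum>j<n. A $$ (i, j) * (((z $ j)\<^sup>2 + (y $ j)\<^sup>2) * z $ j)) = 0"
proof -
  have carr: "y \<in> carrier_vec n" "z \<in> carrier_vec n" "A \<in> carrier_mat n n"
    and det: "det (1\<^sub>m n + vec_diag ((s \<cdot>\<^sub>v z + t \<cdot>\<^sub>v y) ^\<^sub>v 2) * A) = 1"
    and eq: "z + A *\<^sub>v (z ^\<^sub>v 3 + z \<star>\<^sub>v y ^\<^sub>v 2) = 0\<^sub>v n"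
    using assms by (auto simp: V_def)
  have "1\<^sub>m n + vec_diag ((s \<cdot>\<^sub>v z + t \<cdot>\<^sub>v y) ^\<^sub>v 2) * A
      = id_plus_diag n (\<lambda>i. (s * z $ i + t * y $ i)\<^sup>2) A"
    using carr
    by (intro eq_matI) (auto simp: vec_diag_def vec_pow_def id_plus_diag_def mat_diag_mult_left[of _ n n])
  then show "det (id_plus_diag n (\<lambda>i. (s * z $ i + t * y $ i)\<^sup>2) A) = 1"
    using det by simp
  show "z $ i + (\<Sum>j<n. A $$ (i, j) * (((z $ j)\<^sup>2 + (y $ j)\<^sup>2) * z $ j)) = 0" if i: "i < n"
  proof -
    have "(z + A *\<^sub>v (z ^\<^sub>v 3 + z \<star>\<^sub>v y ^\<^sub>v 2)) $ i
      = z $ i + (\<Sum>j<n. A $$ (i, j) * (((z $ j)\<^sup>2 + (y $ j)\<^sup>2) * z $ j))"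
      using carr i
      by (auto simp: vec_prod_def vec_pow_def scalar_prod_def lessThan_atLeast0 algebra_simps
          power2_eq_square power3_eq_cube intro!: sum.cong)
    then show ?thesis
      using eq i by simp
  qed
qed

section \<open>Reduction of Condition C1 to a nonvanishing determinant\<close>

text \<open>A complex square root absorbs \<open>r\<close> into \<open>(s, t)\<close>; later
  arguments vary this scale. Nonsingularity forces the kernel vector \<open>D z\<close> to vanish,
  and then \<open>z = - A (D z) = 0\<close>.\<close>

lemma condition_C1I:
  assumes "\<And>u v. (\<And>r s t. det (id_plus_diag n (\<lambda>i. r * (s * u i + t * v i)\<^sup>2) A) = 1) \<Longrightarrow>
    det (id_plus_diag n (\<lambda>i. (u i)\<^sup>2 + (v i)\<^sup>2) A) \<noteq> 0"
  shows "condition_C1 n A"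
  unfolding condition_C1_def
proof (intro allI impI)
  fix y z assume V: "(y, z, A) \<in> V n"
  define d where "d i = (z $ i)\<^sup>2 + (y $ i)\<^sup>2" for i
  have z: "z $ i = - (\<Sum>j<n. A $$ (i, j) * (d j * z $ j))" if "i < n" for i
    using mem_V_D(2)[OF V that] unfolding d_def by (simp add: eq_neg_iff_add_eq_0)
  have "det (id_plus_diag n d A) \<noteq> 0"
    unfolding d_def
  proof (rule assms)
    fix r s t
    show "det (id_plus_diag n (\<lambda>i. r * (s * z $ i + t * y $ i)\<^sup>2) A) = 1"
      using mem_V_D(1)[OF V, of "csqrt r * s" "csqrt r * t"]
      by (simp add: mult.assoc power_mult_distrib flip: distrib_left)
  qed
  moreover have "d i * z $ i + d i * (\<Sum>j<n. A $$ (i, j) * (d j * z $ j)) = 0" if "i < n" for i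
    by (subst z[OF that]) simp
  ultimately have "\<forall>i<n. d i * z $ i = 0"
    unfolding det_id_plus_diag_eq_0_iff not_ex by (drule_tac x = "\<lambda>i. d i * z $ i" in spec) auto
  then have "z $ i = 0" if "i < n" for i
    using z[OF that] by (simp add: sum.neutral)
  moreover have "z \<in> carrier_vec n"
    using V by (simp add: V_def)
  ultimately show "z = 0\<^sub>v n"
    by (intro eq_vecI) auto
qed

section \<open>Linear forms in two variables with prescribed squares\<close>

text \<open>If \<open>(a, b)\<close> is nonzero, it spans a line containing both pairs; otherwise
  \<open>(c, d)\<close> serves as the common pair \<open>(e, f)\<close>.\<close>

lemma proportional_pairs:
  fixes a b c d :: "'a :: field"
  assumes "a * d = b * c"
  obtains e f g h where "a = g * e" "b = g * f" "c = h * e" "d = h * f"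
proof (cases "a = 0 \<and> b = 0")
  case True
  then show ?thesis
    by (intro that[of 0 c d 1]) auto
next
  case False
  show ?thesis
  proof (cases "a = 0")
    case True
    with False assms have "b \<noteq> 0" "c = 0" by auto
    with True show ?thesis by (intro that[of b 0 1 d]) auto
  next
    case False
    with assms have "d = c / a * b"
      by (simp add: field_simps)
    with False show ?thesis
      by (intro that[of 1 a b "c / a"]) auto
  qed
qed

text \<open>Both sides are homogeneous of degree two in \<open>(a, b)\<close>, so proportional forms
  share a solution \<open>(s, t)\<close>.\<close>

lemma sum_of_squares_scale:
  fixes a b :: complex
  assumes "(s * a + t * b)\<^sup>2 = a\<^sup>2 + b\<^sup>2"
  shows "(s * (c * a) + t * (c * b))\<^sup>2 = (c * a)\<^sup>2 + (c * b)\<^sup>2"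
  using arg_cong[OF assms, of "\<lambda>x. c\<^sup>2 * x"] by (simp add: power2_eq_square algebra_simps)

text \<open>Independent forms take any two values at once, in particular square roots of the two
  sums. Dependent forms reduce to the single equation for their common pair.\<close>

lemma sum_of_squares_two_forms:
  fixes a b c d :: complex
  obtains s t where "(s * a + t * b)\<^sup>2 = a\<^sup>2 + b\<^sup>2" "(s * c + t * d)\<^sup>2 = c\<^sup>2 + d\<^sup>2"
proof (cases "a * d = b * c")
  case False
  define p q e where "p = csqrt (a\<^sup>2 + b\<^sup>2)" and "q = csqrt (c\<^sup>2 + d\<^sup>2)" and "e = a * d - b * c"
  \<comment> \<open>Cramer's rule for \<open>s * a + t * b = p\<close> and
    \<open>s * c + t * d = q\<close>, with determinant \<open>e\<close>.\<close>
  define s t where "s = (p * d - q * b) / e" and "t = (q * a - p * c) / e"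
  have e: "e \<noteq> 0"
    using False by (simp add: e_def)
  have "s * a + t * b = (p * d - q * b) * a / e + (q * a - p * c) * b / e"
    by (simp add: s_def t_def)
  also have "\<dots> = (p * e) / e"
    unfolding add_divide_distrib[symmetric] by (rule arg_cong[of _ _ "\<lambda>x. x / e"]) (simp add: e_def algebra_simps)
  finally have 1: "s * a + t * b = p"
    using e by simp
  have "s * c + t * d = (p * d - q * b) * c / e + (q * a - p * c) * d / e"
    by (simp add: s_def t_def)
  also have "\<dots> = (q * e) / e"
    unfolding add_divide_distrib[symmetric] by (rule arg_cong[of _ _ "\<lambda>x. x / e"]) (simp add: e_def algebra_simps)
  finally have 2: "s * c + t * d = q"
    using e by simp
  show ?thesis
    by (rule that[of s t]) (simp_all add: 1 2 p_def q_def)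
next
  case True
  then obtain e f g h where eq: "a = g * e" "b = g * f" "c = h * e" "d = h * f"
    by (rule proportional_pairs)
  obtain s t where "(s * e + t * f)\<^sup>2 = e\<^sup>2 + f\<^sup>2"
  proof (cases "e = 0")
    case True
    then show ?thesis using that[of 0 1] by simp
  next
    case False
    then show ?thesis using that[of "csqrt (e\<^sup>2 + f\<^sup>2) / e" 0] by simp
  qed
  from sum_of_squares_scale[OF this] show ?thesis
    using that unfolding eq by blast
qed

text \<open>The forms at \<open>i\<close> and \<open>j\<close> are multiples of one form, so with
  the form at \<open>k\<close> only two forms have to be matched.\<close>

lemma sum_of_squares_three_forms:
  fixes a b :: "nat \<Rightarrow> complex"
  assumes "a i * b j = b i * a j"
  obtains s t where "\<And>m. m \<in> {i, j, k} \<Longrightarrow> (s * a m + t * b m)\<^sup>2 = (a m)\<^sup>2 + (b m)\<^sup>2"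
proof -
  obtain e f g h where eq: "a i = g * e" "b i = g * f" "a j = h * e" "b j = h * f"
    using assms by (rule proportional_pairs)
  obtain s t where st: "(s * e + t * f)\<^sup>2 = e\<^sup>2 + f\<^sup>2"
    "(s * a k + t * b k)\<^sup>2 = (a k)\<^sup>2 + (b k)\<^sup>2"
    by (rule sum_of_squares_two_forms)
  have "(s * a m + t * b m)\<^sup>2 = (a m)\<^sup>2 + (b m)\<^sup>2" if "m \<in> {i, j, k}" for m
    using that st(2) sum_of_squares_scale[OF st(1), of g] sum_of_squares_scale[OF st(1), of h]
    unfolding eq[symmetric] by blast
  then show ?thesis by (rule that)
qed

text \<open>With \<open>s = 1\<close>, each index rules out only the root of its form, and the field
  is infinite. For \<open>b i = 0\<close> the quotient is 0 by convention, and avoiding it as well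
  is harmless.\<close>

lemma exists_nonvanishing_point:
  fixes a b :: "'i \<Rightarrow> complex"
  assumes "finite S" and nz: "\<And>i. i \<in> S \<Longrightarrow> a i \<noteq> 0 \<or> b i \<noteq> 0"
  obtains s t where "\<And>i. i \<in> S \<Longrightarrow> s * a i + t * b i \<noteq> 0"
proof -
  obtain t where t: "t \<notin> (\<lambda>i. - a i / b i) ` S"
    using ex_new_if_finite[OF infinite_UNIV_char_0 finite_imageI[OF assms(1)]] by blast
  have "1 * a i + t * b i \<noteq> 0" if "i \<in> S" for i
  proof
    assume 0: "1 * a i + t * b i = 0"
    with nz[OF that] have "b i \<noteq> 0" by auto
    with 0 have "t = - a i / b i" by (simp add: field_simps eq_neg_iff_add_eq_0)
    with t that show False by blast
  qed
  then show ?thesis by (rule that)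
qed

section \<open>Matrices of order 2 and 3\<close>

lemma det_2:
  fixes A :: "'a :: comm_ring_1 mat"
  assumes A: "A \<in> carrier_mat 2 2"
  shows "det A = A $$ (0, 0) * A $$ (1, 1) - A $$ (0, 1) * A $$ (1, 0)"
proof -
  have "det (mat_delete A i 0) = mat_delete A i 0 $$ (0, 0)" for i
    using mat_delete_carrier[OF A] by (intro det_single) simp
  then show ?thesis
    using A by (simp add: laplace_expansion_column[OF A, of 0] cofactor_def mat_delete_def
        numeral_2_eq_2 algebra_simps)
qed

lemma det_3:
  fixes A :: "'a :: comm_ring_1 mat"
  assumes A: "A \<in> carrier_mat 3 3"
  shows "det A = A $$ (0, 0) * (A $$ (1, 1) * A $$ (2, 2) - A $$ (1, 2) * A $$ (2, 1))
    - A $$ (1, 0) * (A $$ (0, 1) * A $$ (2, 2) - A $$ (0, 2) * A $$ (2, 1))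
    + A $$ (2, 0) * (A $$ (0, 1) * A $$ (1, 2) - A $$ (0, 2) * A $$ (1, 1))"
proof -
  have minor: "det (mat_delete A i 0) = mat_delete A i 0 $$ (0, 0) * mat_delete A i 0 $$ (1, 1)
      - mat_delete A i 0 $$ (0, 1) * mat_delete A i 0 $$ (1, 0)" for i
    using mat_delete_carrier[OF A] by (intro det_2) simp
  have "det A = (\<Sum>i<3. A $$ (i, 0) * ((-1) ^ i * det (mat_delete A i 0)))"
    by (simp add: laplace_expansion_column[OF A, of 0] cofactor_def)
  then show ?thesis
    unfolding minor using A by (simp add: mat_delete_def numeral_3_eq_3 numeral_2_eq_2 algebra_simps)
qed

text \<open>Two indices carry at most two forms, so \<open>D\<close> itself is among the diagonals
  of the hypothesis, with \<open>r = 1\<close>.\<close>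

lemma condition_C1_2: "condition_C1 2 A"
proof (rule condition_C1I)
  fix u v :: "nat \<Rightarrow> complex"
  assume det: "\<And>r s t. det (id_plus_diag 2 (\<lambda>i. r * (s * u i + t * v i)\<^sup>2) A) = 1"
  obtain s t where st: "(s * u 0 + t * v 0)\<^sup>2 = (u 0)\<^sup>2 + (v 0)\<^sup>2"
    "(s * u 1 + t * v 1)\<^sup>2 = (u 1)\<^sup>2 + (v 1)\<^sup>2"
    by (rule sum_of_squares_two_forms)
  have "id_plus_diag 2 (\<lambda>i. 1 * (s * u i + t * v i)\<^sup>2) A = id_plus_diag 2 (\<lambda>i. (u i)\<^sup>2 + (v i)\<^sup>2) A"
    using st by (intro id_plus_diag_cong) (auto simp: less_2_cases_iff)
  then show "det (id_plus_diag 2 (\<lambda>i. (u i)\<^sup>2 + (v i)\<^sup>2) A) \<noteq> 0"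
    using det[of 1 s t] by simp
qed

text \<open>The coefficients are the principal minors of \<open>A\<close>, sorted by degree in
  \<open>d\<close>. The minors of order 2 and 3 are kept abstract, since they will be shown to
  vanish.\<close>

lemma det_id_plus_diag_3:
  obtains m01 m02 m12 m where
    "\<And>d. det (id_plus_diag 3 d A) = 1
      + (A $$ (0, 0) * d 0 + A $$ (1, 1) * d 1 + A $$ (2, 2) * d 2)
      + (m01 * (d 0 * d 1) + m02 * (d 0 * d 2) + m12 * (d 1 * d 2)) + m * (d 0 * d 1 * d 2)"
proof (rule that)
  fix d
  let ?a = "\<lambda>i j. A $$ (i, j)"
  show "det (id_plus_diag 3 d A) = 1
      + (?a 0 0 * d 0 + ?a 1 1 * d 1 + ?a 2 2 * d 2)
      + ((?a 0 0 * ?a 1 1 - ?a 0 1 * ?a 1 0) * (d 0 * d 1)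
        + (?a 0 0 * ?a 2 2 - ?a 0 2 * ?a 2 0) * (d 0 * d 2)
        + (?a 1 1 * ?a 2 2 - ?a 1 2 * ?a 2 1) * (d 1 * d 2))
      + (?a 0 0 * (?a 1 1 * ?a 2 2 - ?a 1 2 * ?a 2 1)
        - ?a 1 0 * (?a 0 1 * ?a 2 2 - ?a 0 2 * ?a 2 1)
        + ?a 2 0 * (?a 0 1 * ?a 1 2 - ?a 0 2 * ?a 1 1)) * (d 0 * d 1 * d 2)"
    by (simp add: det_3) (simp add: algebra_simps)
qed

text \<open>Three pairwise independent forms: evaluating at the zero of one form kills all but one of the
  principal minors of order 2, so only the trace, which is additive in the diagonal, survives.\<close>

lemma condition_C1_3: "condition_C1 3 A"
proof (rule condition_C1I)
  fix u v :: "nat \<Rightarrow> complex"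
  assume det: "\<And>r s t. det (id_plus_diag 3 (\<lambda>i. r * (s * u i + t * v i)\<^sup>2) A) = 1"
  show "det (id_plus_diag 3 (\<lambda>i. (u i)\<^sup>2 + (v i)\<^sup>2) A) \<noteq> 0"
  \<comment> \<open>If two forms are proportional, \<open>D\<close> is attained at a single
    \<open>(s, t)\<close>; otherwise all three are pairwise independent.\<close>
  proof (cases "\<exists>i j k. {i, j, k} = {..<3} \<and> u i * v j = v i * u j")
    case True
    then obtain i j k where ijk: "{i, j, k} = {..<3}" and "u i * v j = v i * u j"
      by blast
    from this(2) obtain s t where
      st: "\<And>m. m \<in> {i, j, k} \<Longrightarrow> (s * u m + t * v m)\<^sup>2 = (u m)\<^sup>2 + (v m)\<^sup>2"
      by (rule sum_of_squares_three_forms[where k = k]) blast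
    have "id_plus_diag 3 (\<lambda>i. 1 * (s * u i + t * v i)\<^sup>2) A = id_plus_diag 3 (\<lambda>i. (u i)\<^sup>2 + (v i)\<^sup>2) A"
      using st unfolding ijk by (intro id_plus_diag_cong) simp
    then show ?thesis
      using det[of 1 s t] by simp
  next
    case False
    have "{0, 1, 2} = {..<3::nat}" "{0, 2, 1} = {..<3::nat}" "{1, 2, 0} = {..<3::nat}"
      by auto
    with False have indep: "u 0 * v 1 \<noteq> v 0 * u 1" "u 0 * v 2 \<noteq> v 0 * u 2" "u 1 * v 2 \<noteq> v 1 * u 2"
      by blast+
    obtain m01 m02 m12 m where expand: "\<And>d. det (id_plus_diag 3 d A) = 1
      + (A $$ (0, 0) * d 0 + A $$ (1, 1) * d 1 + A $$ (2, 2) * d 2)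
      + (m01 * (d 0 * d 1) + m02 * (d 0 * d 2) + m12 * (d 1 * d 2)) + m * (d 0 * d 1 * d 2)"
      using det_id_plus_diag_3[of A] by blast
    define w where "w s t i = (s * u i + t * v i)\<^sup>2" for s t i
    define e1 where "e1 s t = A $$ (0, 0) * w s t 0 + A $$ (1, 1) * w s t 1 + A $$ (2, 2) * w s t 2" for s t
    define e2 where "e2 s t = m01 * (w s t 0 * w s t 1) + m02 * (w s t 0 * w s t 2) + m12 * (w s t 1 * w s t 2)" for s t
    define e3 where "e3 s t = m * (w s t 0 * w s t 1 * w s t 2)" for s t
    \<comment> \<open>\<open>e1\<close>, \<open>e2\<close>, \<open>e3\<close> are the parts of
      degree 1, 2, 3 in the diagonal, so scaling by \<open>r\<close> turns the determinant into a
      polynomial in \<open>r\<close> that is constantly 1.\<close>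
    have graded: "r * e1 s t + r\<^sup>2 * e2 s t + r ^ 3 * e3 s t = 0" for r s t
      using det[of r s t]
      unfolding expand w_def[symmetric] e1_def e2_def e3_def
      by (simp add: algebra_simps power2_eq_square power3_eq_cube)
    \<comment> \<open>The values \<open>r = 1\<close> and \<open>r = -1\<close> isolate
      \<open>e2\<close>; \<open>r = 2\<close> then separates \<open>e1\<close> from
      \<open>e3\<close>.\<close>
    have e: "e1 s t = 0 \<and> e2 s t = 0 \<and> e3 s t = 0" for s t
    proof -
      have 1: "e1 s t + e2 s t + e3 s t = 0"
        using graded[of 1] by simp
      have "- e1 s t + e2 s t - e3 s t = 0"
        using graded[of "-1" s t] by simp
      moreover have "2 * e2 s t = (e1 s t + e2 s t + e3 s t) + (- e1 s t + e2 s t - e3 s t)"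
        by simp
      ultimately have 2: "e2 s t = 0"
        using 1 by simp
      have "2 * e1 s t + 8 * e3 s t = 0"
        using graded[of 2 s t] 2 by simp
      with 1 2 have "6 * e3 s t = 0"
        by (simp add: add_eq_0_iff)
      with 1 2 show ?thesis by simp
    qed
    \<comment> \<open>\<open>(v 0, - u 0)\<close> is a zero of form 0, and by independence the other
      two forms are nonzero there. The next two steps treat forms 1 and 2 in the same way.\<close>
    have "m12 = 0"
      using conjunct1[OF conjunct2[OF e[of "v 0" "- u 0"]]] indep by (auto simp: e2_def w_def algebra_simps)
    moreover have "m02 = 0"
      using conjunct1[OF conjunct2[OF e[of "v 1" "- u 1"]]] indep by (auto simp: e2_def w_def algebra_simps)
    moreover have "m01 = 0"
      using conjunct1[OF conjunct2[OF e[of "v 2" "- u 2"]]] indep by (auto simp: e2_def w_def algebra_simps)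
    moreover have "m = 0"
    proof -
      have "u i \<noteq> 0 \<or> v i \<noteq> 0" if "i \<in> {0, 1, 2}" for i
        using that indep by auto
      then obtain s t where "\<And>i. i \<in> {0, 1, 2} \<Longrightarrow> s * u i + t * v i \<noteq> 0"
        using exists_nonvanishing_point[of "{0, 1, 2 :: nat}" u v] by auto
      then show ?thesis
        using conjunct2[OF conjunct2[OF e[of s t]]] by (auto simp: e3_def w_def)
    qed
    \<comment> \<open>Only the linear part remains; the points \<open>(1, 0)\<close> and
      \<open>(0, 1)\<close> contribute the squares of \<open>u\<close> and of
      \<open>v\<close>.\<close>
    ultimately have "det (id_plus_diag 3 (\<lambda>i. (u i)\<^sup>2 + (v i)\<^sup>2) A) = 1 + (e1 1 0 + e1 0 1)"
      unfolding expand by (simp add: e1_def w_def algebra_simps)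
    then show ?thesis
      using e by simp
  qed
qed

section \<open>Rank at most one\<close>

text \<open>A nonzero minor of order 2 would force rank at least 2.\<close>

lemma rank_le_1_minor:
  fixes A :: "complex mat"
  assumes A: "A \<in> carrier_mat n n" and rank: "vec_space.rank n A \<le> 1"
    and lt: "i < n" "j < n" "k < n" "l < n"
  shows "A $$ (i, j) * A $$ (k, l) = A $$ (i, l) * A $$ (k, j)"
proof -
  \<comment> \<open>\<open>submatrix\<close> keeps indices in increasing order, hence the
    restriction to \<open>i < k\<close> and \<open>j < l\<close>; the other orders follow by
    symmetry.\<close>
  have *: "A $$ (i, j) * A $$ (k, l) = A $$ (i, l) * A $$ (k, j)"
    if ik: "i < k" "k < n" and jl: "j < l" "l < n" for i j k l
  proof -
    define B where "B = submatrix A {i, k} {j, l}"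
    have card2: "{a. a < n \<and> a \<in> {i, k}} = {i, k}" "{a. a < n \<and> a \<in> {j, l}} = {j, l}"
      using ik jl by auto
    have B: "B \<in> carrier_mat 2 2"
      using A ik jl by (intro carrier_matI) (simp_all only: B_def dim_submatrix carrier_matD card2, simp_all)
    \<comment> \<open>An entry's position in the submatrix is the number of smaller kept indices: 0
      for \<open>p\<close> and 1 for \<open>q\<close>.\<close>
    have "card {a \<in> {p, q}. a < p} = 0" "card {a \<in> {p, q}. a < q} = 1" if "p < q" for p q :: nat
    proof -
      have "{a \<in> {p, q}. a < p} = {}" "{a \<in> {p, q}. a < q} = {p}"
        using that by auto
      then show "card {a \<in> {p, q}. a < p} = 0" "card {a \<in> {p, q}. a < q} = 1"
        by (simp_all only: card.empty is_singletonI is_singleton_altdef[symmetric])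
    qed
    from this[OF ik(1)] this[OF jl(1)] have "B $$ (0, 0) = A $$ (i, j)" "B $$ (0, 1) = A $$ (i, l)"
      "B $$ (1, 0) = A $$ (k, j)" "B $$ (1, 1) = A $$ (k, l)"
      using submatrix_index_card[of i A j "{i, k}" "{j, l}"] submatrix_index_card[of i A l "{i, k}" "{j, l}"]
        submatrix_index_card[of k A j "{i, k}" "{j, l}"] submatrix_index_card[of k A l "{i, k}" "{j, l}"]
        A ik jl unfolding B_def by (simp_all only: carrier_matD insert_iff simp_thms order.strict_trans)
    moreover have "det B = 0"
    proof (rule ccontr)
      assume "det B \<noteq> 0"
      from vec_space.rank_gt_minor[OF A this[unfolded B_def]] rank show False
        using jl unfolding card2 by simp
    qed
    ultimately show ?thesis
      using det_2[OF B] by simp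
  qed
  consider "i = k" | "j = l" | "i < k" "j < l" | "i < k" "l < j" | "k < i" "j < l" | "k < i" "l < j"
    by linarith
  then show ?thesis
    by cases (use *[of i k j l] *[of i k l j] *[of k i j l] *[of k i l j] lt in \<open>auto simp: mult.commute\<close>)
qed

text \<open>In rank at most one, \<open>det (1 + D A)\<close> equals \<open>1 + tr (D A)\<close>.
  The zeros are compared through kernel vectors; conversely, a nonzero column of \<open>D A\<close>
  is one.\<close>

lemma det_id_plus_diag_rank_le_1_eq_0_iff:
  assumes A: "A \<in> carrier_mat n n" and rank: "vec_space.rank n A \<le> 1"
  shows "det (id_plus_diag n d A) = 0 \<longleftrightarrow> 1 + (\<Sum>i<n. A $$ (i, i) * d i) = 0"
proof
  note minor = rank_le_1_minor[OF A rank]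
  assume "det (id_plus_diag n d A) = 0"
  then obtain x i where i: "i < n" "x i \<noteq> 0" and x: "\<forall>i<n. x i + d i * (\<Sum>j<n. A $$ (i, j) * x j) = 0"
    unfolding det_id_plus_diag_eq_0_iff by blast
  \<comment> \<open>\<open>c\<close> is \<open>A x\<close>, so the kernel equation reads
    \<open>x = - D c\<close>.\<close>
  define c where "c i = (\<Sum>j<n. A $$ (i, j) * x j)" for i
  have x: "x i = - (d i * c i)" if "i < n" for i
    using x that by (simp add: c_def eq_neg_iff_add_eq_0)
  have ci: "c i \<noteq> 0"
    using x[OF i(1)] i(2) by auto
  then obtain q where q: "q < n" "A $$ (i, q) \<noteq> 0"
    unfolding c_def by (metis (no_types, lifting) lessThan_iff mult_zero_left sum.neutral)
  \<comment> \<open>\<open>c\<close> lies in the column space, hence is proportional to column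
    \<open>q\<close>.\<close>
  have c: "A $$ (i, q) * c j = A $$ (j, q) * c i" if "j < n" for j
    unfolding c_def sum_distrib_left
  proof (intro sum.cong refl)
    fix l assume "l \<in> {..<n}"
    then have "A $$ (i, q) * A $$ (j, l) * x l = A $$ (i, l) * A $$ (j, q) * x l"
      using minor[OF i(1) q(1) that] by simp
    then show "A $$ (i, q) * (A $$ (j, l) * x l) = A $$ (j, q) * (A $$ (i, l) * x l)"
      by (simp only: ac_simps)
  qed
  \<comment> \<open>Inserting \<open>x = - D c\<close> and exchanging column indices by
    \<open>minor\<close> makes the trace of \<open>D A\<close> appear.\<close>
  have "A $$ (i, q) * c i = (\<Sum>j<n. - (A $$ (i, j) * d j * (A $$ (i, q) * c j)))"
    unfolding c_def[of i] sum_distrib_left using x by (intro sum.cong) auto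
  also have "\<dots> = (\<Sum>j<n. - (A $$ (i, q) * c i) * (A $$ (j, j) * d j))"
  proof (intro sum.cong refl)
    fix j assume "j \<in> {..<n}"
    then have j: "j < n" by simp
    have "A $$ (i, j) * d j * (A $$ (i, q) * c j) = A $$ (i, j) * A $$ (j, q) * (d j * c i)"
      unfolding c[OF j] by (simp only: ac_simps)
    also have "\<dots> = A $$ (i, q) * A $$ (j, j) * (d j * c i)"
      using minor[OF i(1) j j q(1)] by simp
    finally show "- (A $$ (i, j) * d j * (A $$ (i, q) * c j)) = - (A $$ (i, q) * c i) * (A $$ (j, j) * d j)"
      by (simp only: ac_simps mult_minus_left mult_minus_right)
  qed
  finally have "A $$ (i, q) * c i * (1 + (\<Sum>j<n. A $$ (j, j) * d j)) = 0"
    unfolding sum_distrib_left[symmetric]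
    by (simp only: distrib_left mult_1_right mult_minus_left eq_neg_iff_add_eq_0)
  then show "1 + (\<Sum>i<n. A $$ (i, i) * d i) = 0"
    using q ci by simp
next
  note minor = rank_le_1_minor[OF A rank]
  assume tr: "1 + (\<Sum>i<n. A $$ (i, i) * d i) = 0"
  \<comment> \<open>The trace is -1, so some diagonal entry of \<open>D A\<close> is nonzero; its
    column \<open>p\<close> is the kernel vector.\<close>
  have "\<exists>p<n. A $$ (p, p) * d p \<noteq> 0"
  proof (rule ccontr)
    assume "\<not> ?thesis"
    then have "(\<Sum>i<n. A $$ (i, i) * d i) = 0" by (intro sum.neutral) auto
    with tr show False by simp
  qed
  then obtain p where p: "p < n" "A $$ (p, p) * d p \<noteq> 0" by blast
  have "d i * A $$ (i, p) + d i * (\<Sum>j<n. A $$ (i, j) * (d j * A $$ (j, p))) = 0" if i: "i < n" for i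
  proof -
    have "(\<Sum>j<n. A $$ (i, j) * (d j * A $$ (j, p))) = (\<Sum>j<n. A $$ (i, p) * (A $$ (j, j) * d j))"
    proof (intro sum.cong refl)
      fix j assume "j \<in> {..<n}"
      then have "A $$ (i, j) * A $$ (j, p) * d j = A $$ (i, p) * A $$ (j, j) * d j"
        using minor[of i j j p] i p(1) by simp
      then show "A $$ (i, j) * (d j * A $$ (j, p)) = A $$ (i, p) * (A $$ (j, j) * d j)"
        by (simp only: ac_simps)
    qed
    also have "\<dots> = A $$ (i, p) * (-1)"
      using tr by (simp add: sum_distrib_left[symmetric] add_eq_0_iff)
    finally show ?thesis by simp
  qed
  with p show "det (id_plus_diag n d A) = 0"
    unfolding det_id_plus_diag_eq_0_iff by (intro exI[of _ "\<lambda>i. d i * A $$ (i, p)"]) auto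
qed

text \<open>A nonzero trace \<open>?m\<close> would make the determinant vanish at
  \<open>r = -1 / ?m\<close>. So the trace is zero at every \<open>(s, t)\<close>, and it is
  additive in \<open>D\<close>.\<close>

lemma condition_C1_rank_le_1:
  assumes "A \<in> carrier_mat n n" "vec_space.rank n A \<le> 1"
  shows "condition_C1 n A"
proof (rule condition_C1I)
  fix u v :: "nat \<Rightarrow> complex"
  assume det: "\<And>r s t. det (id_plus_diag n (\<lambda>i. r * (s * u i + t * v i)\<^sup>2) A) = 1"
  note iff = det_id_plus_diag_rank_le_1_eq_0_iff[OF assms]
  have tr: "(\<Sum>i<n. A $$ (i, i) * (s * u i + t * v i)\<^sup>2) = 0" (is "?m = 0") for s t
  proof (rule ccontr)
    assume "?m \<noteq> 0"
    then have "1 + (-1 / ?m) * ?m = 0" by simp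
    then have "1 + (\<Sum>i<n. A $$ (i, i) * ((-1 / ?m) * (s * u i + t * v i)\<^sup>2)) = 0"
      by (simp only: sum_distrib_left mult.left_commute)
    then have "det (id_plus_diag n (\<lambda>i. (-1 / ?m) * (s * u i + t * v i)\<^sup>2) A) = 0"
      unfolding iff .
    then show False
      unfolding det by simp
  qed
  show "det (id_plus_diag n (\<lambda>i. (u i)\<^sup>2 + (v i)\<^sup>2) A) \<noteq> 0"
    unfolding iff using tr[of 1 0] tr[of 0 1] by (simp add: distrib_left sum.distrib)
qed

section \<open>Triangular matrices\<close>

lemma det_id_plus_diag_triangular:
  assumes A: "A \<in> carrier_mat n n" and "upper_triangular A \<or> upper_triangular (transpose_mat A)"
  shows "det (id_plus_diag n d A) = (\<Prod>i<n. 1 + d i * A $$ (i, i))"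
proof -
  have "det (id_plus_diag n d A) = prod_list (diag_mat (id_plus_diag n d A))"
    using assms(2)
  proof
    assume "upper_triangular A"
    then show ?thesis
      using A by (intro det_upper_triangular[of _ n]) (auto simp: id_plus_diag_def upper_triangular_def)
  next
    assume "upper_triangular (transpose_mat A)"
    then have "A $$ (i, j) = 0" if "i < j" "j < n" for i j
      using that A by (auto simp: upper_triangular_def)
    then show ?thesis
      by (intro det_lower_triangular[of n]) auto
  qed
  then show ?thesis
    by (simp add: prod_list_diag_prod id_plus_diag_def lessThan_atLeast0)
qed

text \<open>If some \<open>d i * A $$ (i, i)\<close> were nonzero for a square of forms, a suitable
  \<open>r\<close> would annihilate the factor at \<open>i\<close>. These products are additive in
  \<open>D\<close>, so they also vanish for the sum of squares.\<close>

lemma condition_C1_triangular: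
  assumes "A \<in> carrier_mat n n" "upper_triangular A \<or> upper_triangular (transpose_mat A)"
  shows "condition_C1 n A"
proof (rule condition_C1I)
  fix u v :: "nat \<Rightarrow> complex"
  assume det: "\<And>r s t. det (id_plus_diag n (\<lambda>i. r * (s * u i + t * v i)\<^sup>2) A) = 1"
  note prod = det_id_plus_diag_triangular[OF assms]
  have diag: "(s * u i + t * v i)\<^sup>2 * A $$ (i, i) = 0" (is "?m = 0") if "i < n" for s t i
  proof (rule ccontr)
    assume "?m \<noteq> 0"
    then have "1 + (-1 / ?m) * (s * u i + t * v i)\<^sup>2 * A $$ (i, i) = 0"
      by (simp add: mult.assoc)
    then have "(\<Prod>i<n. 1 + (-1 / ?m) * (s * u i + t * v i)\<^sup>2 * A $$ (i, i)) = 0"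
      using that by (intro prod_zero) blast+
    with det[of "-1 / ?m" s t] show False
      unfolding prod by simp
  qed
  have "((u i)\<^sup>2 + (v i)\<^sup>2) * A $$ (i, i) = 0" if "i < n" for i
    using diag[OF that, of 1 0] diag[OF that, of 0 1] by auto
  then have "(\<Prod>i<n. 1 + ((u i)\<^sup>2 + (v i)\<^sup>2) * A $$ (i, i)) = 1"
    by (intro prod.neutral) simp
  then show "det (id_plus_diag n (\<lambda>i. (u i)\<^sup>2 + (v i)\<^sup>2) A) \<noteq> 0"
    unfolding prod by simp
qed

section \<open>Nonvanishing principal minors\<close>

text \<open>\<open>pick S\<close> and counting smaller elements are inverse to each other; this
  passes between positions in a submatrix and original indices.\<close>

lemma sum_pick_eq:
  assumes "finite S"
  shows "(\<Sum>k<card S. f (pick S k) k) = (\<Sum>i\<in>S. f i (card {a \<in> S. a < i}))"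
proof (rule sum.reindex_bij_witness[of _ "\<lambda>i. card {a \<in> S. a < i}" "pick S"])
  fix i assume "i \<in> S"
  then have "{a \<in> S. a < i} \<subset> S" by auto
  then show "card {a \<in> S. a < i} \<in> {..<card S}"
    using psubset_card_mono[OF assms] by simp
qed (auto simp: card_pick pick_in_set pick_card_in_set)

text \<open>The block of \<open>D A\<close> on the support of \<open>D\<close> is invertible, so it has a nonzero eigenvalue.\<close>

lemma det_id_plus_diag_eq_0_of_minor:
  assumes A: "A \<in> carrier_mat n n" and S: "S \<subseteq> {..<n}" "S \<noteq> {}"
    and minor: "det (submatrix A S S) \<noteq> 0"
    and d: "\<And>i. i \<in> S \<Longrightarrow> d i \<noteq> 0" "\<And>i. i < n \<Longrightarrow> i \<notin> S \<Longrightarrow> d i = 0"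
  obtains r where "det (id_plus_diag n (\<lambda>i. r * d i) A) = 0"
proof -
  define m B M where "m = card S" and "B = submatrix A S S"
    and "M = mat m m (\<lambda>(i, j). d (pick S i) * B $$ (i, j))"
  define pos where "pos i = card {a \<in> S. a < i}" for i
  have fin: "finite S"
    using S finite_subset by blast
  have m: "m > 0"
    using fin S by (simp add: m_def card_gt_0_iff)
  have cardS: "{a. a < n \<and> a \<in> S} = S"
    using S by auto
  have B: "B \<in> carrier_mat m m"
    using A by (intro carrier_matI) (simp_all only: B_def m_def dim_submatrix carrier_matD cardS)
  have B_index: "B $$ (i, j) = A $$ (pick S i, pick S j)" if "i < m" "j < m" for i j
    unfolding B_def using that A by (intro submatrix_index) (simp_all add: cardS m_def)
  have M: "M \<in> carrier_mat m m"
    by (simp add: M_def)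
  obtain e x where x: "x \<in> carrier_vec m" "x \<noteq> 0\<^sub>v m" "M *\<^sub>v x = e \<cdot>\<^sub>v x"
    using spectrum_non_empty[OF M m] M unfolding spectrum_def eigenvalue_def eigenvector_def by auto
  have M_mult: "d (pick S i) * (\<Sum>k<m. B $$ (i, k) * x $ k) = e * x $ i" if "i < m" for i
  proof -
    have "(M *\<^sub>v x) $ i = d (pick S i) * (\<Sum>k<m. B $$ (i, k) * x $ k)"
      using x(1) that by (auto simp: M_def scalar_prod_def lessThan_atLeast0 sum_distrib_left
          mult.assoc intro!: sum.cong)
    then show ?thesis
      using x that by simp
  qed
  \<comment> \<open>Since \<open>d\<close> has no zero on \<open>S\<close>, eigenvalue 0 would put
    \<open>x\<close> into the kernel of \<open>B\<close>, against \<open>minor\<close>.\<close>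
  have e: "e \<noteq> 0"
  proof
    assume "e = 0"
    have "B *\<^sub>v x = 0\<^sub>v m"
    proof (rule eq_vecI)
      fix i assume "i < dim_vec (0\<^sub>v m :: complex vec)"
      then have i: "i < m" by simp
      have "pick S i \<in> S"
        using i by (intro pick_in_set) (simp add: m_def)
      then have "(\<Sum>k<m. B $$ (i, k) * x $ k) = 0"
        using M_mult[OF i] d(1) \<open>e = 0\<close> by simp
      then show "(B *\<^sub>v x) $ i = 0\<^sub>v m $ i"
        using i x(1) B by (simp add: scalar_prod_def lessThan_atLeast0)
    qed (use B in simp)
    with x have "det B = 0"
      unfolding det_0_iff_vec_prod_zero_field[OF B] by blast
    with minor show False by (simp add: B_def)
  qed
  \<comment> \<open>The eigenvector of the block, extended by zero outside \<open>S\<close>.\<close>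
  define X where "X i = (if i \<in> S then x $ pos i else 0)" for i
  have pos: "pos i < m" "pick S (pos i) = i" if "i \<in> S" for i
  proof -
    have "{a \<in> S. a < i} \<subset> S" using that by auto
    then show "pos i < m"
      unfolding pos_def m_def by (rule psubset_card_mono[OF fin])
    show "pick S (pos i) = i"
      unfolding pos_def by (rule pick_card_in_set[OF that])
  qed
  have sum_X: "(\<Sum>j<n. A $$ (i, j) * X j) = (\<Sum>k<m. A $$ (i, pick S k) * x $ k)" for i
  proof -
    have "(\<Sum>j<n. A $$ (i, j) * X j) = (\<Sum>j\<in>S. A $$ (i, j) * x $ pos j)"
      using S by (intro sum.mono_neutral_cong_right) (auto simp: X_def)
    also have "\<dots> = (\<Sum>k<m. A $$ (i, pick S k) * x $ k)"
      using sum_pick_eq[OF fin, of "\<lambda>j k. A $$ (i, j) * x $ k"] by (simp add: pos_def m_def)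
    finally show ?thesis .
  qed
  \<comment> \<open>\<open>D A X = e X\<close> holds on \<open>S\<close> by the eigenvector equation
    and off \<open>S\<close> because \<open>d\<close> and \<open>X\<close> vanish there; hence
    \<open>r = -1 / e\<close>.\<close>
  have "X i + (-1 / e) * d i * (\<Sum>j<n. A $$ (i, j) * X j) = 0" if "i < n" for i
  proof (cases "i \<in> S")
    case True
    have "d i * (\<Sum>j<n. A $$ (i, j) * X j) = d (pick S (pos i)) * (\<Sum>k<m. B $$ (pos i, k) * x $ k)"
      unfolding sum_X using pos[OF True] by (simp add: B_index)
    also have "\<dots> = e * X i"
      using M_mult[OF pos(1)[OF True]] True by (simp add: X_def)
    finally show ?thesis
      using e by (simp add: mult.assoc)
  next
    case False
    then show ?thesis
      using d(2)[OF that] by (simp add: X_def)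
  qed
  moreover have "\<exists>i<n. X i \<noteq> 0"
  proof -
    obtain k where k: "k < m" "x $ k \<noteq> 0"
      using x(1,2) by (metis carrier_vecD eq_vecI index_zero_vec)
    have "pick S k \<in> S" "pos (pick S k) = k"
      using k unfolding pos_def m_def by (simp_all add: pick_in_set card_pick)
    with k S show ?thesis
      by (intro exI[of _ "pick S k"]) (auto simp: X_def)
  qed
  ultimately have "det (id_plus_diag n (\<lambda>i. (-1 / e) * d i) A) = 0"
    unfolding det_id_plus_diag_eq_0_iff by blast
  then show ?thesis by (rule that)
qed

lemma mem_principal_minorsI:
  assumes "S \<subseteq> {..<n}" "S \<noteq> {}"
  shows "det (submatrix A S S) \<in> principal_minors n A"
proof -
  have "{..<n} - ({..<n} - S) = S" "{..<n} - S \<subset> {..<n}"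
    using assms by auto
  then show ?thesis
    unfolding principal_minors_def by (smt (verit) mem_Collect_eq)
qed

text \<open>Where all nonzero forms are nonzero simultaneously, the diagonal has support exactly
  \<open>S\<close>. A nonempty \<open>S\<close> would then give an \<open>r\<close> with determinant
  0 instead of 1.\<close>

lemma condition_C1_principal_minors:
  assumes A: "A \<in> carrier_mat n n" and minors: "\<forall>m\<in>principal_minors n A. m \<noteq> 0"
  shows "condition_C1 n A"
proof (rule condition_C1I)
  fix u v :: "nat \<Rightarrow> complex"
  assume det: "\<And>r s t. det (id_plus_diag n (\<lambda>i. r * (s * u i + t * v i)\<^sup>2) A) = 1"
  define S where "S = {i. i < n \<and> (u i \<noteq> 0 \<or> v i \<noteq> 0)}"
  obtain s t where st: "\<And>i. i \<in> S \<Longrightarrow> s * u i + t * v i \<noteq> 0"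
    using exists_nonvanishing_point[of S u v] by (auto simp: S_def)
  have "S = {}"
  proof (rule ccontr)
    assume "S \<noteq> {}"
    moreover have "S \<subseteq> {..<n}"
      by (auto simp: S_def)
    moreover from this \<open>S \<noteq> {}\<close> have "det (submatrix A S S) \<noteq> 0"
      using mem_principal_minorsI minors by blast
    ultimately obtain r where "det (id_plus_diag n (\<lambda>i. r * (s * u i + t * v i)\<^sup>2) A) = 0"
      using det_id_plus_diag_eq_0_of_minor[OF A, of S "\<lambda>i. (s * u i + t * v i)\<^sup>2"] st
      by (auto simp: S_def)
    with det show False by simp
  qed
  then have "id_plus_diag n (\<lambda>i. (u i)\<^sup>2 + (v i)\<^sup>2) A = id_plus_diag n (\<lambda>i. 0 * (0 * u i + 0 * v i)\<^sup>2) A"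
    by (intro id_plus_diag_cong) (auto simp: S_def)
  then show "det (id_plus_diag n (\<lambda>i. (u i)\<^sup>2 + (v i)\<^sup>2) A) \<noteq> 0"
    using det[of 0 0 0] by simp
qed

section \<open>Density by small scalar shifts\<close>

text \<open>A principal minor of \<open>A + x\<close> vanishes only if \<open>- x\<close> is an
  eigenvalue of the corresponding block of \<open>A\<close>; there are finitely many blocks, each
  with finite spectrum.\<close>

lemma finite_bad_shifts:
  fixes A :: "complex mat"
  assumes A: "A \<in> carrier_mat n n"
  shows "finite {x. \<exists>m\<in>principal_minors n (A + x \<cdot>\<^sub>m 1\<^sub>m n). m = 0}"
proof (rule finite_subset)
  show "finite (\<Union>S\<in>Pow {..<n}. uminus ` spectrum (submatrix A S S))"
  proof (intro finite_UN_I finite_imageI)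
    fix S assume "S \<in> Pow {..<n}"
    have "submatrix A S S \<in> carrier_mat (card {i. i < n \<and> i \<in> S}) (card {i. i < n \<and> i \<in> S})"
      using A by (intro carrier_matI) (simp_all only: dim_submatrix carrier_matD)
    then show "finite (spectrum (submatrix A S S))"
      by (rule card_finite_spectrum(1))
  qed simp
  show "{x. \<exists>m\<in>principal_minors n (A + x \<cdot>\<^sub>m 1\<^sub>m n). m = 0}
      \<subseteq> (\<Union>S\<in>Pow {..<n}. uminus ` spectrum (submatrix A S S))"
  proof
    fix x assume "x \<in> {x. \<exists>m\<in>principal_minors n (A + x \<cdot>\<^sub>m 1\<^sub>m n). m = 0}"
    then obtain K where K: "det (submatrix (A + x \<cdot>\<^sub>m 1\<^sub>m n) ({..<n} - K) ({..<n} - K)) = 0"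
      unfolding principal_minors_def by auto
    define S where "S = {..<n} - K"
    define m where "m = card S"
    have S: "S \<subseteq> {..<n}" "{i. i < n \<and> i \<in> S} = S"
      by (auto simp: S_def)
    have B: "submatrix A S S \<in> carrier_mat m m"
      using A by (intro carrier_matI) (simp_all only: dim_submatrix carrier_matD S m_def)
    have "submatrix (A + x \<cdot>\<^sub>m 1\<^sub>m n) S S = char_matrix (submatrix A S S) (- x)"
    proof (rule eq_matI)
      fix i j assume "i < dim_row (char_matrix (submatrix A S S) (- x))"
        "j < dim_col (char_matrix (submatrix A S S) (- x))"
      then have ij: "i < m" "j < m"
        using B by (simp_all add: char_matrix_def)
      have p: "pick S i < n" "pick S j < n"
        using pick_in_set[of i S] pick_in_set[of j S] ij S(1) by (auto simp: m_def)
      \<comment> \<open>Injectivity of \<open>pick S\<close> makes the shift by \<open>x\<close>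
        restrict to the same scalar shift of the block.\<close>
      have inj: "pick S i = pick S j \<longleftrightarrow> i = j"
        using card_pick[of i S] card_pick[of j S] ij by (metis m_def)
      have "submatrix (A + x \<cdot>\<^sub>m 1\<^sub>m n) S S $$ (i, j) = (A + x \<cdot>\<^sub>m 1\<^sub>m n) $$ (pick S i, pick S j)"
        using A ij by (intro submatrix_index) (simp_all add: S m_def)
      moreover have "submatrix A S S $$ (i, j) = A $$ (pick S i, pick S j)"
        using A ij by (intro submatrix_index) (simp_all add: S m_def)
      ultimately show "submatrix (A + x \<cdot>\<^sub>m 1\<^sub>m n) S S $$ (i, j) = char_matrix (submatrix A S S) (- x) $$ (i, j)"
        using A B ij p inj by (simp add: char_matrix_def)
    qed (use A B in \<open>simp_all add: char_matrix_def dim_submatrix S m_def\<close>)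
    then have "- x \<in> spectrum (submatrix A S S)"
      using K unfolding spectrum_def mem_Collect_eq eigenvalue_det[OF B] by (simp add: S_def)
    with S(1) show "x \<in> (\<Union>S\<in>Pow {..<n}. uminus ` spectrum (submatrix A S S))"
      by (intro UN_I[of S] image_eqI[of _ _ "- x"]) auto
  qed
qed

lemma condition_C1_dense:
  "mat_topology n closure_of {A \<in> carrier_mat n n. condition_C1 n A} = carrier_mat n n"
  unfolding mat_topology_def Metric_space.metric_closure_of[OF Metric_space_mat]
proof (intro equalityI subsetI CollectI conjI allI impI)
  fix A :: "complex mat" and \<epsilon> :: real
  assume A: "A \<in> carrier_mat n n" and \<epsilon>: "\<epsilon> > 0"
  define bad where "bad = {x. \<exists>m\<in>principal_minors n (A + x \<cdot>\<^sub>m 1\<^sub>m n). m = 0}"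
  \<comment> \<open>A real shift by \<open>y > 0\<close> moves \<open>A\<close> by distance
    \<open>n * y\<close>; the denominator \<open>n + 1\<close> also covers
    \<open>n = 0\<close>.\<close>
  have "infinite ({0<..<\<epsilon> / (n + 1)} - Re ` bad)"
    using \<epsilon> finite_bad_shifts[OF A] by (intro Diff_infinite_finite) (simp_all add: bad_def infinite_Ioo)
  then obtain y where y: "0 < y" "y < \<epsilon> / (n + 1)" "y \<notin> Re ` bad"
    using not_finite_existsD by (metis (no_types, lifting) Diff_iff ex_in_conv finite.emptyI greaterThanLessThan_iff)
  define B where "B = A + complex_of_real y \<cdot>\<^sub>m 1\<^sub>m n"
  have B: "B \<in> carrier_mat n n"
    using A by (simp add: B_def)
  have "complex_of_real y \<notin> bad"
    using y(3) by force
  then have "condition_C1 n B"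
    unfolding bad_def using B by (intro condition_C1_principal_minors) (auto simp: B_def)
  moreover have "mat_dist n A B < \<epsilon>"
  proof -
    have "mat_dist n A B = (\<Sum>i<n. \<Sum>j<n. if i = j then y else 0)"
      unfolding mat_dist_def using A y(1) by (intro sum.cong) (auto simp: B_def)
    also have "\<dots> = n * y"
      by simp
    also have "\<dots> \<le> (n + 1) * y"
      using y(1) by simp
    also have "\<dots> < \<epsilon>"
      using y(2) by (simp add: field_simps)
    finally show ?thesis .
  qed
  ultimately show "\<exists>B\<in>{A \<in> carrier_mat n n. condition_C1 n A}.
      B \<in> Metric_space.mball (carrier_mat n n) (mat_dist n) A \<epsilon>"
    using A B by (intro bexI[of _ B]) (auto simp: Metric_space.in_mball[OF Metric_space_mat])
qed auto

theorem theorem1p8: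
  fixes n :: nat
  shows "(\<forall>A :: complex mat. A \<in> carrier_mat n n \<longrightarrow>
      (n = 2 \<or> n = 3 \<longrightarrow> condition_C1 n A) \<and>
      (vec_space.rank n A = 1 \<longrightarrow> condition_C1 n A) \<and>
      (upper_triangular A \<or> upper_triangular (transpose_mat A) \<longrightarrow> condition_C1 n A) \<and>
      ((\<forall>m \<in> principal_minors n A. m \<noteq> 0) \<longrightarrow> condition_C1 n A)) \<and>
    mat_topology n closure_of {A \<in> carrier_mat n n. condition_C1 n A} = carrier_mat n n"
  using condition_C1_2 condition_C1_3 condition_C1_rank_le_1 condition_C1_triangular
    condition_C1_principal_minors condition_C1_dense
  by auto

end
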